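(* Let $T$ be a weighted tree with $n$ vertices and with edge weights $\alpha_1,\alpha_2,\ldots,\alpha_{n-1}$, and let $D_q(T)$ be its $q$-distance matrix. Then, for any $n\geq 4$, $$\det(D_q(T))=(-1)^{n-1}\left(\prod_{i=1}^{n-1}[2\alpha_i]\right)\left(\frac{[\alpha_1][\alpha_{2}][\alpha_1+\alpha_{2}]}{[2\alpha_1][2\alpha_{2}]}+\frac{[\alpha_{n-2}][\alpha_{n-1}][\alpha_{n-2}+\alpha_{n-1}]}{[2\alpha_{n-2}][2\alpha_{n-1}]}+\sum_{i=1}^{n-3}\frac{[\alpha_i][\alpha_{i+2}][\alpha_i+\alpha_{i+2}]}{[2\alpha_i][2\alpha_{i+2}]}\right),$$ which is independent of the structure of $T$.
   Context: A weighted tree is a tree in which each edge carries a weight; write $V(T)=\{v_1,v_2,\ldots,v_n\}$ for the vertex set of $T$. For two vertices $u,v$ of $T$, the distance $d(u,v)$ is $0$ if $u=v$, and otherwise is the sum of the weights of the edges on the unique path from $u$ to $v$ in $T$. Put $[\alpha]=\frac{1-q^{\alpha}}{1-q}$ if $q\neq 1$ and $[\alpha]=\alpha$ otherwise; thus $[0]=0$, and $[\alpha]=1+q+\cdots+q^{\alpha-1}$ if $\alpha$ is a positive integer. The $q$-distance matrix $D_q(T)$ is the $n\times n$ matrix whose $(i,j)$-entry is $d_q(v_i,v_j)=[d(v_i,v_j)]$; for $q=1$ it is the ordinary distance matrix of $T$. *)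

theory Defs
  imports
    "HOL-Analysis.Complex_Transcendental"
    "Jordan_Normal_Form.Determinant"
begin

text \<open>
  A simple graph is given by a vertex set and a set of two-element subsets of it; a weighting
  assigns a number to each edge. The tree predicate of the AFP entry Graph_Theory only
  excludes directed cycles, so it does not describe undirected trees.
\<close>

definition simple_graph :: "'a set \<Rightarrow> 'a set set \<Rightarrow> bool" where
  "simple_graph V E \<longleftrightarrow> (\<forall>e\<in>E. e \<subseteq> V \<and> card e = 2)"

definition is_path :: "'a set \<Rightarrow> 'a set set \<Rightarrow> 'a list \<Rightarrow> bool" where
  "is_path V E p \<longleftrightarrow> p \<noteq> [] \<and> distinct p \<and> set p \<subseteq> V \<and>
     (\<forall>i. Suc i < length p \<longrightarrow> {p ! i, p ! Suc i} \<in> E)"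

definition path_between :: "'a set \<Rightarrow> 'a set set \<Rightarrow> 'a \<Rightarrow> 'a \<Rightarrow> 'a list \<Rightarrow> bool" where
  "path_between V E u v p \<longleftrightarrow> is_path V E p \<and> hd p = u \<and> last p = v"

definition connected_graph :: "'a set \<Rightarrow> 'a set set \<Rightarrow> bool" where
  "connected_graph V E \<longleftrightarrow> V \<noteq> {} \<and> (\<forall>u\<in>V. \<forall>v\<in>V. \<exists>p. path_between V E u v p)"

definition is_cycle :: "'a set \<Rightarrow> 'a set set \<Rightarrow> 'a list \<Rightarrow> bool" where
  "is_cycle V E p \<longleftrightarrow> is_path V E p \<and> 3 \<le> length p \<and> {last p, hd p} \<in> E"

definition is_tree :: "'a set \<Rightarrow> 'a set set \<Rightarrow> bool" where
  "is_tree V E \<longleftrightarrow> finite V \<and> simple_graph V E \<and> connected_graph V E \<and>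
     (\<nexists>p. is_cycle V E p)"

definition path_weight :: "('a set \<Rightarrow> complex) \<Rightarrow> 'a list \<Rightarrow> complex" where
  "path_weight w p = (\<Sum>i<length p - 1. w {p ! i, p ! Suc i})"

definition tree_dist ::
  "'a set \<Rightarrow> 'a set set \<Rightarrow> ('a set \<Rightarrow> complex) \<Rightarrow> 'a \<Rightarrow> 'a \<Rightarrow> complex" where
  "tree_dist V E w u v =
     (if u = v then 0 else path_weight w (THE p. path_between V E u v p))"

text \<open>
  For \<open>q \<noteq> 0\<close> the power \<open>q\<^sup>a\<close> is \<open>exp (a * Ln q)\<close> with the principal logarithm; it is the
  ordinary power if \<open>a\<close> is an integer, and the usual real power if \<open>q > 0\<close> and \<open>a\<close> is real.
  The library's \<open>0 powr 0\<close> is \<open>0\<close>, whereas here \<open>q\<^sup>0 = 1\<close> for every \<open>q\<close> (as needed for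
  \<open>[0] = 0\<close> when \<open>q = 0\<close>), hence the case distinction.
\<close>

definition qpow :: "complex \<Rightarrow> complex \<Rightarrow> complex" where
  "qpow q a = (if a = 0 then 1 else q powr a)"

definition qnum :: "complex \<Rightarrow> complex \<Rightarrow> complex" where
  "qnum q a = (if q = 1 then a else (1 - qpow q a) / (1 - q))"

lemma qnum_0: "qnum q 0 = 0"
  by (simp add: qnum_def qpow_def)

lemma qnum_of_nat: "qnum q (of_nat k) = (\<Sum>i<k. q ^ i)"
proof (cases "q = 1")
  case False
  have "qpow q (of_nat k) = q ^ k"
    by (cases "q = 0") (auto simp: qpow_def powr_nat)
  with False show ?thesis
    by (simp add: qnum_def sum_gp_strict)
qed (simp add: qnum_def)

text \<open>Rows and columns are indexed from \<open>0\<close>, following the enumeration \<open>v 0, \<dots>, v (n - 1)\<close>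
  of the vertices.\<close>

definition q_distance_matrix ::
  "complex \<Rightarrow> nat \<Rightarrow> (nat \<Rightarrow> 'a) \<Rightarrow> 'a set \<Rightarrow> 'a set set \<Rightarrow> ('a set \<Rightarrow> complex) \<Rightarrow> complex mat" where
  "q_distance_matrix q n v V E w =
     mat n n (\<lambda>(i, j). qnum q (tree_dist V E w (v i) (v j)))"

text \<open>A weighted tree with its vertices listed as \<open>v 0, \<dots>, v (n - 1)\<close>, in which
  \<open>\<alpha> 1, \<dots>, \<alpha> (n - 1)\<close> are the weights of the edges in some order.\<close>

definition weighted_tree ::
  "nat \<Rightarrow> (nat \<Rightarrow> 'a) \<Rightarrow> 'a set \<Rightarrow> 'a set set \<Rightarrow> ('a set \<Rightarrow> complex) \<Rightarrow> (nat \<Rightarrow> complex) \<Rightarrow> bool" where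
  "weighted_tree n v V E w \<alpha> \<longleftrightarrow> is_tree V E \<and> bij_betw v {0..<n} V \<and>
     (\<exists>e. bij_betw e {1..n - 1} E \<and> (\<forall>i\<in>{1..n - 1}. w (e i) = \<alpha> i))"

end

theory Submission
  imports Defs
begin

text \<open>
  With \<open>t = 1 - q\<close> one has \<open>[a + b] = [a] + [b] - t [a] [b]\<close>, so the row of a leaf attached by an edge
  of weight \<open>a\<close> is, off the diagonal, \<open>1 - t [a]\<close> times the row of its neighbour plus the constant
  \<open>[a]\<close>. One row and one column operation therefore leave a matrix bordered by a constant, whose
  determinant is that of the smaller tree's matrix with a constant added to every entry. Hence
  the statement that is closed under adding leaves is the one about \<open>D + x J\<close>, with \<open>J\<close> the
  all-ones matrix:
  \<open>det (D + x J) = (\<Prod>e. - [2 a\<^sub>e]) * ((1 + x t) * (\<Sum>e. [a\<^sub>e]\<^sup>2 / [2 a\<^sub>e]) + x)\<close>.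
  The paper's summands are \<open>[a] [b] [a + b] / ([2 a] [2 b]) = ([a]\<^sup>2 / [2 a] + [b]\<^sup>2 / [2 b]) / 2\<close>.
\<close>

section \<open>Paths and their weights\<close>

lemma is_path_iff_successively:
  "is_path V E p \<longleftrightarrow>
     p \<noteq> [] \<and> distinct p \<and> set p \<subseteq> V \<and> successively (\<lambda>a b. {a, b} \<in> E) p"
  by (auto simp: is_path_def successively_conv_nth)

lemma path_between_rev: "path_between V E u v p \<Longrightarrow> path_between V E v u (rev p)"
  by (auto simp: path_between_def is_path_iff_successively hd_rev last_rev insert_commute)

lemma path_weight_singleton: "path_weight w [a] = 0"
  by (simp add: path_weight_def)

lemma path_weight_snoc:
  assumes "p \<noteq> []"
  shows "path_weight w (p @ [a]) = path_weight w p + w {last p, a}"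
proof -
  obtain k where k: "length p = Suc k"
    using assms by (cases p) auto
  have "path_weight w (p @ [a]) = (\<Sum>i<Suc k. w {(p @ [a]) ! i, (p @ [a]) ! Suc i})"
    by (simp add: path_weight_def k)
  also have "\<dots> = (\<Sum>i<k. w {p ! i, p ! Suc i}) + w {last p, a}"
    using k assms by (simp add: nth_append last_conv_nth)
  finally show ?thesis
    by (simp add: path_weight_def k)
qed

lemma path_weight_rev: "path_weight w (rev p) = path_weight w p"
proof -
  have "path_weight w (rev p) = (\<Sum>i<length p - 1. w {p ! (length p - Suc i), p ! (length p - Suc (Suc i))})"
    unfolding path_weight_def by (intro sum.cong) (auto simp: rev_nth)
  \<comment> \<open>A path has edges \<open>0, ..., length p - 2\<close>, and edge \<open>i\<close>
    of the reversed path is edge \<open>length p - 2 - i\<close> of \<open>p\<close>.\<close>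
  also have "\<dots> = (\<Sum>i<length p - 1. w {p ! i, p ! Suc i})"
    by (rule sum.reindex_bij_witness[where i = "\<lambda>i. length p - 2 - i" and j = "\<lambda>i. length p - 2 - i"])
       (auto simp: insert_commute Suc_diff_Suc numeral_2_eq_2)
  finally show ?thesis
    by (simp add: path_weight_def)
qed

lemma path_between_refl: "path_between V E u u p \<Longrightarrow> p = [u]"
  by (cases p) (auto simp: path_between_def is_path_iff_successively split: if_splits)

lemma path_between_endpoints: "path_between V E u v p \<Longrightarrow> u \<in> V \<and> v \<in> V"
  by (auto simp: path_between_def is_path_def)

lemma tree_path_exists:
  assumes "is_tree V E" "u \<in> V" "v \<in> V"
  obtains p where "path_between V E u v p"
  using assms unfolding is_tree_def connected_graph_def by blast

section \<open>Leaves and uniqueness of paths\<close>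

definition pendant_edge :: "'a set set \<Rightarrow> 'a \<Rightarrow> 'a \<Rightarrow> bool" where
  "pendant_edge E l c \<longleftrightarrow> {l, c} \<in> E \<and> l \<noteq> c \<and> (\<forall>e\<in>E. l \<in> e \<longrightarrow> e = {l, c})"

text \<open>The first vertex \<open>a\<close> of a longest path is a leaf: a further edge
  \<open>{a, c}\<close> would lengthen the path if \<open>c\<close> lies off it, and would close a
  cycle with the stretch from \<open>a\<close> to \<open>c\<close> if \<open>c\<close> lies beyond
  the second vertex.\<close>

lemma tree_has_pendant_edge:
  assumes T: "is_tree V E" and card: "card V \<ge> 2"
  obtains l c where "l \<in> V" "c \<in> V" "pendant_edge E l c"
proof -
  have fin: "finite V" and sg: "simple_graph V E" and cg: "connected_graph V E"
    and acyc: "\<nexists>p. is_cycle V E p"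
    using T by (auto simp: is_tree_def)
  have bound: "length p \<le> card V" if "is_path V E p" for p
    using that fin by (metis is_path_def card_mono distinct_card)
  obtain u v where uv: "u \<in> V" "v \<in> V" "u \<noteq> v"
    using card card_le_Suc0_iff_eq[OF fin] by force
  then obtain p0 where p0: "is_path V E p0" "hd p0 = u" "last p0 = v"
    using cg by (auto simp: connected_graph_def path_between_def)
  have "length p0 \<ge> 2"
    using p0 uv by (cases p0 rule: remdups_adj.cases) (auto simp: is_path_def)
  obtain p where p: "is_path V E p" and max: "\<And>p'. is_path V E p' \<Longrightarrow> length p' \<le> length p"
    using ex_has_greatest_nat[of "is_path V E" p0 length "Suc (card V)"] p0(1) bound by force
  have "length p \<ge> 2"
    using max[OF p0(1)] \<open>length p0 \<ge> 2\<close> by simp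
  then obtain a b r where pab: "p = a # b # r"
    by (cases p rule: remdups_adj.cases) auto
  have ab: "a \<in> V" "b \<in> V" "a \<noteq> b" "{a, b} \<in> E"
    using p by (auto simp: pab is_path_iff_successively)
  have "e = {a, b}" if e: "e \<in> E" "a \<in> e" for e
  proof -
    have "e \<subseteq> V" "card e = 2"
      using sg e by (auto simp: simple_graph_def)
    then obtain c where c: "e = {a, c}" "c \<noteq> a" "c \<in> V"
      using e(2) by (auto simp: card_2_iff)
    have "c \<in> set p"
    proof (rule ccontr)
      assume "c \<notin> set p"
      then have "is_path V E (c # p)"
        using p c e(1) by (auto simp: is_path_iff_successively pab insert_commute)
      then show False
        using max by fastforce
    qed
    moreover have "c \<notin> set r"
    proof
      assume "c \<in> set r"
      then obtain r1 r2 where r: "r = r1 @ c # r2"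
        by (auto simp: in_set_conv_decomp)
      have "p = (a # b # r1 @ [c]) @ r2"
        by (simp add: pab r)
      then have "is_path V E (a # b # r1 @ [c])"
        using p by (metis is_path_iff_successively successively_append_iff distinct_append
            set_append le_sup_iff list.distinct(1))
      then have "is_cycle V E (a # b # r1 @ [c])"
        using c(1) e(1) by (simp add: is_cycle_def insert_commute)
      then show False
        using acyc by blast
    qed
    ultimately show ?thesis
      using c by (auto simp: pab)
  qed
  then show ?thesis
    using that ab unfolding pendant_edge_def by blast
qed

text \<open>An interior vertex of a path has two neighbours on it, distinct because the path does
  not repeat vertices, whereas a leaf has only one neighbour.\<close>

lemma leaf_not_interior:
  assumes p: "is_path V E p" and ends: "hd p \<noteq> l" "last p \<noteq> l"
    and leaf: "pendant_edge E l c"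
  shows "l \<notin> set p"
proof
  assume "l \<in> set p"
  then obtain p1 p2 where p12: "p = p1 @ l # p2"
    by (auto simp: in_set_conv_decomp)
  have ne: "p1 \<noteq> []" "p2 \<noteq> []"
    using ends by (auto simp: p12)
  have "{last p1, l} \<in> E" "{l, hd p2} \<in> E"
    using p ne by (auto simp: is_path_iff_successively p12 successively_append_iff successively_Cons)
  then have "{last p1, l} = {l, c}" "{l, hd p2} = {l, c}"
    using leaf unfolding pendant_edge_def by (metis insertCI)+
  then have "last p1 = hd p2"
    by (auto simp: doubleton_eq_iff)
  moreover have "last p1 \<in> set p1" "hd p2 \<in> set p2"
    using ne by auto
  moreover have "set p1 \<inter> set p2 = {}"
    using p by (auto simp: is_path_def p12)
  ultimately show False
    by auto
qed

text \<open>Since paths between other vertices avoid \<open>l\<close>, deleting the leaf neither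
  creates nor destroys any of them. Connectedness, uniqueness of paths and distances thus pass
  between a tree and the tree without the leaf.\<close>

lemma path_between_delete_leaf_iff:
  assumes leaf: "pendant_edge E l c" and "u \<noteq> l" "v \<noteq> l"
  shows "path_between (V - {l}) (E - {{l, c}}) u v p \<longleftrightarrow> path_between V E u v p"
proof
  assume "path_between (V - {l}) (E - {{l, c}}) u v p"
  then show "path_between V E u v p"
    by (auto simp: path_between_def is_path_def)
next
  assume p: "path_between V E u v p"
  then have "l \<notin> set p"
    using assms leaf_not_interior[of V E p l c] by (auto simp: path_between_def)
  moreover from this have "{p ! i, p ! Suc i} \<noteq> {l, c}" if "Suc i < length p" for i
    using that nth_mem[of i p] nth_mem[of "Suc i" p] by (auto simp: doubleton_eq_iff)
  ultimately show "path_between (V - {l}) (E - {{l, c}}) u v p"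
    using p by (auto simp: path_between_def is_path_def)
qed

lemma is_tree_delete_leaf:
  assumes T: "is_tree V E" and leaf: "pendant_edge E l c"
    and c: "c \<in> V"
  shows "is_tree (V - {l}) (E - {{l, c}})"
  unfolding is_tree_def
proof (intro conjI)
  show "finite (V - {l})"
    using T by (simp add: is_tree_def)
  show "simple_graph (V - {l}) (E - {{l, c}})"
    using T leaf by (fastforce simp: is_tree_def simple_graph_def pendant_edge_def)
  show "connected_graph (V - {l}) (E - {{l, c}})"
    using T c leaf
    by (auto simp: is_tree_def connected_graph_def path_between_delete_leaf_iff[OF leaf] pendant_edge_def)
  show "\<nexists>p. is_cycle (V - {l}) (E - {{l, c}}) p"
    using T by (force simp: is_tree_def is_cycle_def is_path_def)
qed

lemma path_to_leaf:
  assumes p: "path_between V E u l p" and "u \<noteq> l"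
    and leaf: "pendant_edge E l c"
  obtains p' where "p = p' @ [l]" "path_between V E u c p'"
proof -
  have path: "is_path V E p" "hd p = u" "last p = l"
    using p by (auto simp: path_between_def)
  then obtain p' where p': "p = p' @ [l]"
    by (metis append_butlast_last_id is_path_def)
  have "p' \<noteq> []"
    using path(2) \<open>u \<noteq> l\<close> p' by auto
  have "{last p', l} \<in> E"
    using path(1) \<open>p' \<noteq> []\<close> by (auto simp: p' is_path_iff_successively successively_append_iff)
  then have "last p' = c"
    using leaf by (auto simp: pendant_edge_def doubleton_eq_iff)
  then have "path_between V E u c p'"
    using path \<open>p' \<noteq> []\<close> by (auto simp: path_between_def p' is_path_iff_successively successively_append_iff)
  then show thesis
    using that p' by blast
qed

text \<open>This makes the \<open>THE\<close> in \<open>tree_dist\<close> meaningful. By induction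
  on the number of vertices: delete a leaf \<open>l\<close>. Paths between other vertices survive in
  the smaller tree, and a path into \<open>l\<close> is determined by its part up to the neighbour
  of \<open>l\<close>. A path out of \<open>l\<close> is reversed first.\<close>

lemma tree_path_unique:
  assumes "is_tree V E" "path_between V E u v p" "path_between V E u v p'"
  shows "p = p'"
  using assms
proof (induction "card V" arbitrary: V E u v p p' rule: less_induct)
  case less
  have uv: "u \<in> V" "v \<in> V"
    using path_between_endpoints[OF less.prems(2)] by auto
  have fin: "finite V"
    using less.prems(1) by (simp add: is_tree_def)
  show ?case
  proof (cases "u = v")
    case True
    then show ?thesis
      using less.prems path_between_refl by metis
  next
    case False
    then have "card V \<ge> 2"
      using uv card_le_Suc0_iff_eq[OF fin] by (metis not_less_eq_eq numeral_2_eq_2)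
    then obtain l c where lc: "l \<in> V" "c \<in> V" and leaf: "pendant_edge E l c"
      using tree_has_pendant_edge[OF less.prems(1)] by metis
    have "l \<noteq> c"
      using leaf by (simp add: pendant_edge_def)
    have *: "r = r'" if "path_between V E a b r" "path_between V E a b r'" "a \<noteq> l" "b \<noteq> l" for a b r r'
      by (rule less.hyps[OF card_Diff1_less[OF fin lc(1)] is_tree_delete_leaf[OF less.prems(1) leaf lc(2)], of a b])
         (simp_all add: path_between_delete_leaf_iff[OF leaf] that)
    have to_leaf: "r = r'" if "path_between V E a l r" "path_between V E a l r'" "a \<noteq> l" for a r r'
      using path_to_leaf[OF that(1,3) leaf] path_to_leaf[OF that(2,3) leaf] * that(3) \<open>l \<noteq> c\<close> by metis
    consider "u \<noteq> l" "v \<noteq> l" | "v = l" | "u = l"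
      by blast
    then show ?thesis
    proof cases
      case 1
      then show ?thesis
        using * less.prems by blast
    next
      case 2
      then show ?thesis
        using to_leaf less.prems False by blast
    next
      case 3
      then have "rev p = rev p'"
        using to_leaf[of v "rev p" "rev p'"] False
          less.prems(2,3)[THEN path_between_rev] by blast
      then show ?thesis
        by simp
    qed
  qed
qed

section \<open>Distances in a tree\<close>

lemma tree_dist_eq_path_weight:
  assumes "is_tree V E" "path_between V E u v p"
  shows "tree_dist V E w u v = path_weight w p"
proof (cases "u = v")
  case True
  then show ?thesis
    using assms path_between_refl by (fastforce simp: tree_dist_def path_weight_singleton)
next
  case False
  have "(THE p. path_between V E u v p) = p"
    using assms by (intro the_equality) (auto intro: tree_path_unique)
  with False show ?thesis
    by (simp add: tree_dist_def)
qed

lemma tree_dist_self [simp]: "tree_dist V E w u u = 0"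
  by (simp add: tree_dist_def)

lemma tree_dist_commute:
  assumes "is_tree V E" "u \<in> V" "v \<in> V"
  shows "tree_dist V E w u v = tree_dist V E w v u"
proof -
  obtain p where p: "path_between V E u v p"
    using tree_path_exists assms by metis
  show ?thesis
    using tree_dist_eq_path_weight[OF assms(1) p] tree_dist_eq_path_weight[OF assms(1) path_between_rev[OF p]]
    by (simp add: path_weight_rev)
qed

lemma tree_dist_leaf:
  assumes T: "is_tree V E" and leaf: "pendant_edge E l c"
    and "u \<in> V" "l \<in> V" "u \<noteq> l"
  shows "tree_dist V E w u l = tree_dist V E w u c + w {l, c}"
proof -
  obtain p where p: "path_between V E u l p"
    using tree_path_exists assms by metis
  from path_to_leaf[OF p \<open>u \<noteq> l\<close> leaf]
  obtain p' where p': "p = p' @ [l]" "path_between V E u c p'" .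
  then have "p' \<noteq> []" "last p' = c"
    by (auto simp: path_between_def is_path_def)
  then show ?thesis
    using tree_dist_eq_path_weight[OF T p] tree_dist_eq_path_weight[OF T p'(2)]
    by (simp add: p'(1) path_weight_snoc insert_commute)
qed

lemma tree_dist_delete_leaf:
  assumes leaf: "pendant_edge E l c" and "u \<noteq> l" "v \<noteq> l"
  shows "tree_dist (V - {l}) (E - {{l, c}}) w u v = tree_dist V E w u v"
proof -
  have "path_between (V - {l}) (E - {{l, c}}) u v = path_between V E u v"
    using path_between_delete_leaf_iff[OF assms] by blast
  then show ?thesis
    by (simp add: tree_dist_def)
qed

text \<open>Applied with \<open>G = qpow_domain q\<close>, so that the addition law for
  \<open>qnum q\<close> is available for distances and not only for edge weights.\<close>

lemma tree_dist_in_closed: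
  assumes T: "is_tree V E" and uv: "u \<in> V" "v \<in> V" and "0 \<in> G"
    and add: "\<And>a b. a \<in> G \<Longrightarrow> b \<in> G \<Longrightarrow> a + b \<in> G" and E: "\<And>e. e \<in> E \<Longrightarrow> w e \<in> G"
  shows "tree_dist V E w u v \<in> G"
proof -
  obtain p where p: "path_between V E u v p"
    using tree_path_exists assms by metis
  have sum: "sum f A \<in> G" if "finite A" "\<And>i. i \<in> A \<Longrightarrow> f i \<in> G" for f :: "nat \<Rightarrow> complex" and A
    using that by (induction A rule: finite_induct) (auto simp: \<open>0 \<in> G\<close> add)
  show ?thesis
    unfolding tree_dist_eq_path_weight[OF T p] path_weight_def
    using p by (intro sum E) (auto simp: path_between_def is_path_def)
qed

section \<open>Determinants of bordered matrices\<close>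

text \<open>Changing the enumeration permutes rows and columns by the same permutation, whose sign
  enters twice and cancels. This allows a leaf to be listed last.\<close>

lemma det_reindex:
  fixes f :: "'a \<Rightarrow> 'a \<Rightarrow> 'b :: comm_ring_1"
  assumes v: "bij_betw v {0..<n} V" and v': "bij_betw v' {0..<n} V"
  shows "det (mat n n (\<lambda>(i, j). f (v i) (v j))) = det (mat n n (\<lambda>(i, j). f (v' i) (v' j)))"
proof -
  define p where "p i = (if i < n then inv_into {0..<n} v' (v i) else i)" for i
  have p_eq: "p i = (inv_into {0..<n} v' \<circ> v) i" if "i \<in> {0..<n}" for i
    using that by (simp add: p_def)
  have "bij_betw p {0..<n} {0..<n}"
    using bij_betw_trans[OF v bij_betw_inv_into[OF v']] bij_betw_cong[of "{0..<n}" p, OF p_eq] by blast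
  then have p: "p permutes {0..<n}"
    by (rule bij_imp_permutes) (simp add: p_def)
  have v_eq: "v i = v' (p i)" if "i < n" for i
    using that v' bij_betw_apply[OF v, of i] by (simp add: p_def bij_betw_inv_into_right)
  have p_less: "p i < n" if "i < n" for i
    using permutes_in_image[OF p, of i] that by simp
  define A where "A = mat n n (\<lambda>(i, j). f (v' i) (v' j))"
  define B where "B = mat n n (\<lambda>(i, j). A $$ (p i, j))"
  have [simp]: "A \<in> carrier_mat n n" "B \<in> carrier_mat n n"
    by (simp_all add: A_def B_def)
  \<comment> \<open>\<open>B\<close> has its rows permuted; the columns are permuted as rows of the
    transpose.\<close>
  have "mat n n (\<lambda>(i, j). f (v i) (v j)) =
      transpose_mat (mat n n (\<lambda>(i, j). transpose_mat B $$ (p i, j)))"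
    by (rule eq_matI) (simp_all add: A_def B_def p_less v_eq)
  then have "det (mat n n (\<lambda>(i, j). f (v i) (v j))) =
      det (mat n n (\<lambda>(i, j). transpose_mat B $$ (p i, j)))"
    by (simp add: det_transpose[of _ n])
  also have "\<dots> = signof p * (signof p * det A)"
    using det_permute_rows[OF _ p, of "transpose_mat B"] det_permute_rows[OF _ p, of A]
    by (simp add: det_transpose[of _ n] B_def)
  also have "\<dots> = det A"
    by (simp add: sign_def)
  finally show ?thesis
    by (simp add: A_def)
qed

text \<open>The Schur complement of the corner entry \<open>c\<close>. As the border is constant,
  the correction is the same number \<open>b\<^sup>2 / c\<close> in every entry, so the shape
  "matrix plus a constant" is preserved.\<close>

lemma det_bordered_const:
  fixes A :: "nat \<Rightarrow> nat \<Rightarrow> 'a :: field"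
  assumes "c \<noteq> 0"
  shows "det (mat (Suc n) (Suc n)
      (\<lambda>(i, j). if i < n \<and> j < n then A i j else if i < n \<or> j < n then b else c)) =
    c * det (mat n n (\<lambda>(i, j). A i j - b\<^sup>2 / c))"
proof -
  \<comment> \<open>Block factorization: \<open>?U\<close> is upper unitriangular and
    \<open>?L\<close> is lower block triangular with the Schur complement \<open>?D\<close> and
    \<open>c\<close> on its diagonal.\<close>
  let ?U = "four_block_mat (1\<^sub>m n) (mat n 1 (\<lambda>_. b / c)) (0\<^sub>m 1 n) (1\<^sub>m 1)"
  let ?D = "mat n n (\<lambda>(i, j). A i j - b\<^sup>2 / c)"
  let ?L = "four_block_mat ?D (0\<^sub>m n 1) (mat 1 n (\<lambda>_. b)) (mat 1 1 (\<lambda>_. c))"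
  have U: "?U \<in> carrier_mat (Suc n) (Suc n)" and L: "?L \<in> carrier_mat (Suc n) (Suc n)"
    by (auto intro!: carrier_matI)
  have "?U * ?L = four_block_mat (mat n n (\<lambda>(i, j). A i j)) (mat n 1 (\<lambda>_. b))
      (mat 1 n (\<lambda>_. b)) (mat 1 1 (\<lambda>_. c))"
    by (subst mult_four_block_mat[where ?nr1.0 = n and ?n1.0 = n and ?n2.0 = 1 and ?nr2.0 = 1
          and ?nc1.0 = n and ?nc2.0 = 1])
       (use assms in \<open>auto simp: scalar_prod_def power2_eq_square intro!: eq_matI\<close>)
  also have "\<dots> = mat (Suc n) (Suc n)
      (\<lambda>(i, j). if i < n \<and> j < n then A i j else if i < n \<or> j < n then b else c)"
    by (rule eq_matI) auto
  finally have "det (mat (Suc n) (Suc n)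
      (\<lambda>(i, j). if i < n \<and> j < n then A i j else if i < n \<or> j < n then b else c)) = det ?U * det ?L"
    by (metis det_mult[OF U L])
  also have "det ?U = 1"
    by (subst det_four_block_mat_lower_left_zero[where n = n and m = 1]) auto
  also have "det ?L = det ?D * c"
    by (subst det_four_block_mat_upper_right_zero[where n = n and m = 1]) (auto simp: det_single)
  finally show ?thesis
    by simp
qed

text \<open>Index \<open>n\<close> is the leaf and \<open>k\<close> its neighbour. Subtracting
  \<open>1 - t * y\<close> times row \<open>k\<close> from row \<open>n\<close>, and then likewise
  for the columns, turns the border into the constant \<open>b = y + x - (1 - t * y) * x\<close> and
  the corner into \<open>c\<close>.\<close>

lemma det_add_leaf:
  fixes A :: "nat \<Rightarrow> nat \<Rightarrow> 'a :: field"
  assumes k: "k < n" "A k k = 0" and diag: "A n n = 0"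
    and row: "\<And>j. j < n \<Longrightarrow> A n j = y + (1 - t * y) * A k j"
    and col: "\<And>i. i < n \<Longrightarrow> A i n = y + (1 - t * y) * A i k"
    and b: "b = y * (1 + x * t)" and c: "c = x * t\<^sup>2 * y\<^sup>2 - 2 * (1 - t * y) * y" "c \<noteq> 0"
  shows "det (mat (Suc n) (Suc n) (\<lambda>(i, j). A i j + x)) =
    c * det (mat n n (\<lambda>(i, j). A i j + (x - b\<^sup>2 / c)))"
proof -
  define M where "M = mat (Suc n) (Suc n) (\<lambda>(i, j). A i j + x)"
  define N where "N = addcol (- (1 - t * y)) n k (addrow (- (1 - t * y)) n k M)"
  have M: "M \<in> carrier_mat (Suc n) (Suc n)"
    by (simp add: M_def)
  have "det N = det M"
    using k M by (simp add: N_def det_addcol[of _ "Suc n"] det_addrow[of _ "Suc n"])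
  moreover have nk: "A n k = y" "A k n = y"
    using row[OF k(1)] col[OF k(1)] k(2) by simp_all
  have "N = mat (Suc n) (Suc n)
      (\<lambda>(i, j). if i < n \<and> j < n then A i j + x else if i < n \<or> j < n then b else c)"
    using k diag row col
    by (intro eq_matI) (auto simp: nk N_def M_def b c(1) less_Suc_eq power2_eq_square algebra_simps)
  ultimately show ?thesis
    using det_bordered_const[OF c(2), of n "\<lambda>i j. A i j + x" b] by (simp add: M_def add_diff_eq)
qed

text \<open>By the Leibniz formula the determinant is a polynomial in \<open>x\<close>.\<close>

lemma continuous_on_det_add_const:
  fixes A :: "nat \<Rightarrow> nat \<Rightarrow> complex"
  shows "continuous_on UNIV (\<lambda>x. det (mat n n (\<lambda>(i, j). A i j + x)))"
proof -
  have "det (mat n n (\<lambda>(i, j). A i j + x)) =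
      (\<Sum>p | p permutes {0..<n}. signof p * (\<Prod>i = 0..<n. A i (p i) + x))" for x
    by (subst det_def'[where n = n])
       (auto intro!: sum.cong prod.cong arg_cong2[where f = "(*)"] dest: permutes_in_image)
  then show ?thesis
    by (auto intro!: continuous_intros)
qed

text \<open>The inductive step in algebraic form. With \<open>t = 1 - q\<close> and
  \<open>y = [a]\<close> for the new edge weight \<open>a\<close>, the term
  \<open>2 * y - t * y\<^sup>2\<close> is \<open>[2 a]\<close>. The hypothesis \<open>IH\<close> is
  stated for all constants because it is used at \<open>x - b\<^sup>2 / c\<close>.\<close>

lemma det_leaf_step:
  fixes A :: "nat \<Rightarrow> nat \<Rightarrow> complex"
  assumes k: "k < n" "A k k = 0" and diag: "A n n = 0"
    and row: "\<And>j. j < n \<Longrightarrow> A n j = y + (1 - t * y) * A k j"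
    and col: "\<And>i. i < n \<Longrightarrow> A i n = y + (1 - t * y) * A i k"
    and nz: "2 * y - t * y\<^sup>2 \<noteq> 0"
    and IH: "\<And>x. det (mat n n (\<lambda>(i, j). A i j + x)) = P * ((1 + x * t) * S + x)"
  shows "det (mat (Suc n) (Suc n) (\<lambda>(i, j). A i j + x)) =
    - (2 * y - t * y\<^sup>2) * P * ((1 + x * t) * (S + y\<^sup>2 / (2 * y - t * y\<^sup>2)) + x)"
proof -
  define F where "F x = det (mat (Suc n) (Suc n) (\<lambda>(i, j). A i j + x))" for x
  define G where "G x = - (2 * y - t * y\<^sup>2) * P * ((1 + x * t) * (S + y\<^sup>2 / (2 * y - t * y\<^sup>2)) + x)" for x
  define c where "c x = x * t\<^sup>2 * y\<^sup>2 - 2 * (1 - t * y) * y" for x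
  have eq: "F x = G x" if "c x \<noteq> 0" for x
  proof -
    define z where "z = 2 * y - t * y\<^sup>2"
    define b where "b = y * (1 + x * t)"
    have "z \<noteq> 0"
      using nz by (simp add: z_def)
    have "F x = c x * (P * ((1 + (x - b\<^sup>2 / c x) * t) * S + (x - b\<^sup>2 / c x)))"
      unfolding F_def
      using det_add_leaf[where A = A and k = k and n = n and y = y and t = t and x = x and b = b and c = "c x"]
        assms that by (simp add: b_def c_def)
    also have "\<dots> = P * (((1 + x * t) * c x - b\<^sup>2 * t) * S + (c x * x - b\<^sup>2))"
      using that by (simp add: field_simps)
    \<comment> \<open>In both brackets the quadratic terms in \<open>x\<close> cancel, so the result
      is again affine in \<open>x\<close>, of the same shape with \<open>S\<close> enlarged by
      \<open>y\<^sup>2 / z\<close>.\<close>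
    also have "(1 + x * t) * c x - b\<^sup>2 * t = - z * (1 + x * t)"
      by (simp add: c_def b_def z_def power2_eq_square algebra_simps)
    also have "c x * x - b\<^sup>2 = - (1 + x * t) * y\<^sup>2 - z * x"
      by (simp add: c_def b_def z_def power2_eq_square algebra_simps)
    also have "P * (- z * (1 + x * t) * S + (- (1 + x * t) * y\<^sup>2 - z * x)) = G x"
      using \<open>z \<noteq> 0\<close> unfolding G_def z_def[symmetric] by (simp add: field_simps)
    finally show ?thesis .
  qed
  (* c vanishes for at most one x, where F = G follows by continuity. *)
  have "isCont F x" "isCont G x" for x
    using continuous_on_det_add_const[of "Suc n" A]
    by (auto simp: F_def[abs_def] G_def[abs_def] continuous_on_eq_continuous_at intro!: continuous_intros)
  then have lim: "F \<midarrow>x\<rightarrow> F x" "G \<midarrow>x\<rightarrow> G x" for x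
    by (auto simp: isCont_def)
  have "F x = G x"
  proof (cases "t = 0")
    \<comment> \<open>Here \<open>c x\<close> is the constant \<open>- 2 * y\<close>, nonzero by
      \<open>nz\<close>.\<close>
    case True
    then show ?thesis
      using nz by (intro eq) (simp add: c_def)
  next
    case False
    have "y \<noteq> 0"
      using nz by auto
    have "c z = t\<^sup>2 * y\<^sup>2 * (z - 2 * (1 - t * y) / (t\<^sup>2 * y))" for z
      using False \<open>y \<noteq> 0\<close> by (simp add: c_def field_simps power2_eq_square)
    then have "c z \<noteq> 0" if "z \<noteq> 2 * (1 - t * y) / (t\<^sup>2 * y)" for z
      using that False \<open>y \<noteq> 0\<close> by simp
    then have "eventually (\<lambda>z. F z = G z) (at x)"
      using eventually_neq_at_within[of "2 * (1 - t * y) / (t\<^sup>2 * y)" x UNIV]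
      by (auto elim!: eventually_mono intro: eq)
    then have "F \<midarrow>x\<rightarrow> G x"
      using lim(2) tendsto_cong by blast
    then show ?thesis
      using lim(1) tendsto_unique trivial_limit_at by blast
  qed
  then show ?thesis
    by (simp add: F_def G_def)
qed

section \<open>Arithmetic of q-numbers\<close>

text \<open>A set closed under addition on which \<open>qpow q\<close> is multiplicative; for \<open>q = 0\<close> this fails
  on all of \<open>\<complex>\<close>, as \<open>0\<^sup>a * 0\<^sup>-\<^sup>a = 0 \<noteq> 0\<^sup>0\<close>.\<close>
definition qpow_domain :: "complex \<Rightarrow> complex set" where
  "qpow_domain q = (if q = 0 then insert 0 {a. Re a > 0} else UNIV)"

lemma zero_in_qpow_domain: "0 \<in> qpow_domain q"
  by (simp add: qpow_domain_def)

lemma add_in_qpow_domain: "a \<in> qpow_domain q \<Longrightarrow> b \<in> qpow_domain q \<Longrightarrow> a + b \<in> qpow_domain q"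
  by (auto simp: qpow_domain_def split: if_splits)

lemma qpow_add:
  assumes "a \<in> qpow_domain q" "b \<in> qpow_domain q"
  shows "qpow q (a + b) = qpow q a * qpow q b"
proof (cases "q = 0")
  case True
  \<comment> \<open>At \<open>q = 0\<close> the value of \<open>qpow\<close> is 1 at exponent 0 and
    0 elsewhere. Positive real parts keep the sum of two nonzero exponents away from 0, so both
    sides vanish there.\<close>
  have "a + b \<noteq> 0" if "a \<noteq> 0" "b \<noteq> 0"
  proof -
    have "Re (a + b) > 0"
      using assms that True by (simp add: qpow_domain_def)
    then show ?thesis
      by (metis less_irrefl zero_complex.sel(1))
  qed
  with True show ?thesis
    by (cases "a = 0"; cases "b = 0") (simp_all add: qpow_def)
next
  case False
  then show ?thesis
    by (auto simp: qpow_def powr_add add_eq_0_iff powr_minus)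
qed

text \<open>For \<open>q \<noteq> 1\<close> this is multiplicativity of \<open>qpow q\<close>
  rewritten through \<open>qpow q a = 1 - (1 - q) * qnum q a\<close>; at \<open>q = 1\<close> the
  correction term vanishes.\<close>

lemma qnum_add:
  assumes "a \<in> qpow_domain q" "b \<in> qpow_domain q"
  shows "qnum q (a + b) = qnum q a + qnum q b - (1 - q) * qnum q a * qnum q b"
proof (cases "q = 1")
  case False
  have "(1 - x * y) / u = (1 - x) / u + (1 - y) / u - u * ((1 - x) / u) * ((1 - y) / u)"
    if "u \<noteq> 0" for x y u :: complex
    using that by (simp add: field_simps)
  from this[of "1 - q"] show ?thesis
    using False by (simp add: qnum_def qpow_add[OF assms])
qed (simp add: qnum_def)

lemma qnum_double:
  assumes "a \<in> qpow_domain q"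
  shows "qnum q (2 * a) = 2 * qnum q a - (1 - q) * (qnum q a)\<^sup>2"
  using qnum_add[OF assms assms] by (simp add: power2_eq_square mult.assoc flip: mult_2)

text \<open>After clearing denominators both sides become
  \<open>2 [a] [b] ([a] + [b] - t [a] [b])\<close> with \<open>t = 1 - q\<close>. The split turns a
  sum over pairs of edges into a sum over single edges.\<close>

lemma qnum_pair_split:
  assumes "a \<in> qpow_domain q" "b \<in> qpow_domain q" "qnum q (2 * a) \<noteq> 0" "qnum q (2 * b) \<noteq> 0"
  shows "qnum q a * qnum q b * qnum q (a + b) / (qnum q (2 * a) * qnum q (2 * b)) =
    ((qnum q a)\<^sup>2 / qnum q (2 * a) + (qnum q b)\<^sup>2 / qnum q (2 * b)) / 2"
proof -
  have "2 * (qnum q a * qnum q b * qnum q (a + b)) =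
      (qnum q a)\<^sup>2 * qnum q (2 * b) + (qnum q b)\<^sup>2 * qnum q (2 * a)"
    unfolding qnum_add[OF assms(1,2)] qnum_double[OF assms(1)] qnum_double[OF assms(2)]
    by (simp add: power2_eq_square algebra_simps)
  moreover have "p / (y * z) = (r / y + s / z) / 2"
    if "2 * p = r * z + s * y" "y \<noteq> 0" "z \<noteq> 0" for p r s y z :: complex
    using that by (simp add: field_simps)
  ultimately show ?thesis
    using assms(3,4) by blast
qed

section \<open>Induction over trees\<close>

lemma bij_betw_extend_last:
  assumes "bij_betw v {0..<n} (V - {l})" "l \<in> V"
  shows "bij_betw (v(n := l)) {0..<Suc n} V"
proof -
  have "bij_betw (v(n := l)) {0..<n} (V - {l})"
    using assms(1) by (subst bij_betw_cong[of _ _ v]) auto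
  from bij_betw_combine[OF this, of "{n}" "{l}"] show ?thesis
    using assms(2) by (simp add: bij_betw_def insert_absorb atLeast0_lessThan_Suc)
qed

lemma finite_edges:
  assumes "is_tree V E"
  shows "finite E"
proof -
  have "E \<subseteq> Pow V" "finite V"
    using assms by (auto simp: is_tree_def simple_graph_def)
  then show ?thesis
    by (meson finite_Pow_iff finite_subset)
qed

lemma tree_single_vertex_no_edges:
  assumes "is_tree V E" "card V < 2"
  shows "E = {}"
proof (rule ccontr)
  assume "E \<noteq> {}"
  then obtain e where "e \<subseteq> V" "card e = 2"
    using assms(1) by (auto simp: is_tree_def simple_graph_def)
  then show False
    using assms card_mono[of V e] by (simp add: is_tree_def)
qed

text \<open>Induction on the number of vertices, with the tree, the enumeration and the constant
  \<open>x\<close> all generalized: removing a leaf changes each of them.\<close>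

lemma det_q_distance_add_const:
  assumes "is_tree V E" "bij_betw v {0..<n} V" "\<And>e. e \<in> E \<Longrightarrow> w e \<in> qpow_domain q"
    and "\<And>e. e \<in> E \<Longrightarrow> qnum q (2 * w e) \<noteq> 0"
  shows "det (mat n n (\<lambda>(i, j). qnum q (tree_dist V E w (v i) (v j)) + x)) =
    (\<Prod>e\<in>E. - qnum q (2 * w e)) *
      ((1 + x * (1 - q)) * (\<Sum>e\<in>E. (qnum q (w e))\<^sup>2 / qnum q (2 * w e)) + x)"
  using assms
proof (induction n arbitrary: V E v x)
  \<comment> \<open>The formula would give \<open>x\<close> for the empty determinant 1, but
    \<open>connected_graph\<close> excludes the empty vertex set.\<close>
  case 0
  then have "V = {}"
    by (simp add: bij_betw_def)
  with "0.prems"(1) show ?case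
    by (simp add: is_tree_def connected_graph_def)
next
  case (Suc n)
  note T = Suc.prems(1)
  have fin: "finite V" "finite E"
    using T finite_edges by (auto simp: is_tree_def)
  have card: "card V = Suc n"
    using bij_betw_same_card[OF Suc.prems(2)] by simp
  show ?case
  proof (cases "n = 0")
    \<comment> \<open>A single vertex: the matrix has the one entry \<open>x\<close>, and the empty
      product and sum leave \<open>x\<close> on the right.\<close>
    case True
    then have "E = {}"
      using tree_single_vertex_no_edges[OF T] card by simp
    then show ?thesis
      using True by (simp add: det_single qnum_0)
  next
    case False
    then obtain l c where lc: "l \<in> V" "c \<in> V" and leaf: "pendant_edge E l c"
      using tree_has_pendant_edge[OF T] card by (metis Suc_le_mono one_le_numeral le_neq_implies_less
          less_one not_less numeral_2_eq_2 One_nat_def)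
    define V' where "V' = V - {l}"
    define E' where "E' = E - {{l, c}}"
    have leaf': "{l, c} \<in> E" "l \<noteq> c"
      using leaf by (auto simp: pendant_edge_def)
    have E: "E = insert {l, c} E'" "{l, c} \<notin> E'" "finite E'"
      using leaf' fin by (auto simp: E'_def)
    have "card V' = n"
      using card lc fin by (simp add: V'_def)
    then obtain v0 where v0: "bij_betw v0 {0..<n} V'"
      using ex_bij_betw_nat_finite[of V'] fin by (auto simp: V'_def)
    \<comment> \<open>An enumeration with the leaf in last position, as \<open>det_leaf_step\<close>
      requires; \<open>det_reindex\<close> relates it to the given \<open>v\<close>.\<close>
    define v' where "v' = v0(n := l)"
    have v': "bij_betw v' {0..<Suc n} V"
      unfolding v'_def by (rule bij_betw_extend_last) (use v0 lc in \<open>simp_all add: V'_def\<close>)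
    have v'_old: "v' i \<in> V" "v' i \<noteq> l" "v' i = v0 i" if "i < n" for i
      using bij_betw_apply[OF v0, of i] that by (auto simp: v'_def V'_def)
    have v'_n: "v' n = l"
      by (simp add: v'_def)
    obtain k where k: "k < n" "v' k = c"
    proof -
      have "c \<in> v0 ` {0..<n}"
        using v0 lc leaf' by (auto simp: V'_def bij_betw_def)
      then show thesis
        using that v'_old(3) by auto
    qed
    define A where "A i j = qnum q (tree_dist V E w (v' i) (v' j))" for i j
    define y where "y = qnum q (w {l, c})"
    have dom: "tree_dist V E w u u' \<in> qpow_domain q" if "u \<in> V" "u' \<in> V" for u u'
      using T that zero_in_qpow_domain add_in_qpow_domain Suc.prems(3) by (rule tree_dist_in_closed)
    have col: "A i n = y + (1 - (1 - q) * y) * A i k" if "i < n" for i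
      using qnum_add[OF dom[of "v' i" c] Suc.prems(3)[OF leaf'(1)]] v'_old[OF that] lc k
        tree_dist_leaf[OF T leaf, of "v' i" w]
      by (simp add: A_def y_def v'_n algebra_simps)
    have sym: "A i j = A j i" if "i < Suc n" "j < Suc n" for i j
      using that bij_betw_apply[OF v'] by (auto simp: A_def intro!: arg_cong[where f = "qnum q"] tree_dist_commute[OF T])
    have row: "A n j = y + (1 - (1 - q) * y) * A k j" if "j < n" for j
      using col[OF that] sym[of n j] sym[of k j] that k by simp
    define P where "P = (\<Prod>e\<in>E'. - qnum q (2 * w e))"
    define S where "S = (\<Sum>e\<in>E'. (qnum q (w e))\<^sup>2 / qnum q (2 * w e))"
    have T': "is_tree V' E'"
      unfolding V'_def E'_def by (rule is_tree_delete_leaf[OF T leaf lc(2)])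
    have IH: "det (mat n n (\<lambda>(i, j). A i j + z)) = P * ((1 + z * (1 - q)) * S + z)" for z
    proof -
      have "mat n n (\<lambda>(i, j). A i j + z) =
          mat n n (\<lambda>(i, j). qnum q (tree_dist V' E' w (v0 i) (v0 j)) + z)"
        by (rule eq_matI)
           (simp_all add: A_def V'_def E'_def tree_dist_delete_leaf[OF leaf] v'_old flip: v'_old(3))
      then show ?thesis
        using Suc.IH[OF T' v0] Suc.prems(3,4) by (simp add: P_def S_def E'_def)
    qed
    have dbl: "qnum q (2 * w {l, c}) = 2 * y - (1 - q) * y\<^sup>2"
      unfolding y_def by (rule qnum_double) (rule Suc.prems(3)[OF leaf'(1)])
    have "det (mat (Suc n) (Suc n) (\<lambda>(i, j). qnum q (tree_dist V E w (v i) (v j)) + x)) =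
        det (mat (Suc n) (Suc n) (\<lambda>(i, j). A i j + x))"
      unfolding A_def by (rule det_reindex[OF Suc.prems(2) v'])
    also have "\<dots> = - qnum q (2 * w {l, c}) * P *
        ((1 + x * (1 - q)) * (S + y\<^sup>2 / qnum q (2 * w {l, c})) + x)"
      unfolding dbl
    proof (rule det_leaf_step[OF k(1) _ _ row col _ IH])
      show "A k k = 0" "A n n = 0"
        by (simp_all add: A_def qnum_0)
      show "2 * y - (1 - q) * y\<^sup>2 \<noteq> 0"
        using Suc.prems(4)[OF leaf'(1)] dbl by simp
    qed
    also have "\<dots> = (\<Prod>e\<in>E. - qnum q (2 * w e)) *
      ((1 + x * (1 - q)) * (\<Sum>e\<in>E. (qnum q (w e))\<^sup>2 / qnum q (2 * w e)) + x)"
      using E(2,3) by (simp add: E(1) P_def S_def y_def add.commute)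
    finally show ?thesis .
  qed
qed

section \<open>The determinant in terms of the listed weights\<close>

text \<open>The case \<open>x = 0\<close>, transported along the listing of the edges. The
  right-hand side involves only \<open>q\<close>, \<open>n\<close> and \<open>\<alpha>\<close>,
  which is what gives independence of the tree.\<close>

lemma det_q_distance_matrix:
  assumes T: "weighted_tree n v V E w \<alpha>"
    and dom: "\<And>i. i \<in> {1..n - 1} \<Longrightarrow> \<alpha> i \<in> qpow_domain q"
    and nz: "\<And>i. i \<in> {1..n - 1} \<Longrightarrow> qnum q (2 * \<alpha> i) \<noteq> 0"
  shows "det (q_distance_matrix q n v V E w) =
    (-1) ^ (n - 1) * (\<Prod>i=1..n - 1. qnum q (2 * \<alpha> i)) *
      (\<Sum>i=1..n - 1. (qnum q (\<alpha> i))\<^sup>2 / qnum q (2 * \<alpha> i))"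
proof -
  obtain e where e: "bij_betw e {1..n - 1} E" "\<forall>i\<in>{1..n - 1}. w (e i) = \<alpha> i"
    and tree: "is_tree V E" "bij_betw v {0..<n} V"
    using T by (auto simp: weighted_tree_def)
  have E: "E = e ` {1..n - 1}"
    using e(1) by (simp add: bij_betw_def)
  have "(\<Prod>d\<in>E. - qnum q (2 * w d)) = (\<Prod>i=1..n - 1. - qnum q (2 * \<alpha> i))"
    using e(2) by (subst prod.reindex_bij_betw[OF e(1), symmetric]) simp
  also have "\<dots> = (-1) ^ (n - 1) * (\<Prod>i=1..n - 1. qnum q (2 * \<alpha> i))"
    by (simp add: prod_uminus)
  finally have P: "(\<Prod>d\<in>E. - qnum q (2 * w d)) = (-1) ^ (n - 1) * (\<Prod>i=1..n - 1. qnum q (2 * \<alpha> i))" .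
  have S: "(\<Sum>d\<in>E. (qnum q (w d))\<^sup>2 / qnum q (2 * w d)) =
      (\<Sum>i=1..n - 1. (qnum q (\<alpha> i))\<^sup>2 / qnum q (2 * \<alpha> i))"
    using e(2) by (subst sum.reindex_bij_betw[OF e(1), symmetric]) simp
  have "w d \<in> qpow_domain q" "qnum q (2 * w d) \<noteq> 0" if "d \<in> E" for d
    using that dom nz e(2) unfolding E by auto
  from det_q_distance_add_const[OF tree this, where x = 0] show ?thesis
    by (simp add: q_distance_matrix_def P S)
qed

text \<open>The index pairs \<open>(1, 2)\<close>, \<open>(n - 2, n - 1)\<close> and \<open>(i, i + 2)\<close> are the edges of a Hamiltonian
  cycle on \<open>{1..n - 1}\<close>, so every index occurs in exactly two of them.\<close>
lemma sum_over_cycle_pairs: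
  fixes f :: "nat \<Rightarrow> 'a :: field_char_0"
  assumes "n \<ge> 4"
  shows "(f 1 + f 2) / 2 + (f (n - 2) + f (n - 1)) / 2 + (\<Sum>i=1..n - 3. (f i + f (i + 2)) / 2) =
    (\<Sum>i=1..n - 1. f i)"
proof -
  \<comment> \<open>With \<open>n = k + 4\<close> no truncated subtraction remains. Passing from
    \<open>k\<close> to \<open>k + 1\<close> replaces the pair \<open>(k + 2, k + 3)\<close> by
    \<open>(k + 3, k + 4)\<close> and adds \<open>(k + 2, k + 4)\<close>, a net gain of
    \<open>2 * f (k + 4)\<close>.\<close>
  have cycle: "(f 1 + f 2) + (f (k + 2) + f (k + 3)) + (\<Sum>i=1..k + 1. f i + f (i + 2)) =
      2 * (\<Sum>i=1..k + 3. f i)" for k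
  proof (induction k)
    case 0
    show ?case
      by (simp add: eval_nat_numeral)
  next
    case (Suc k)
    then show ?case
      by (simp add: eval_nat_numeral algebra_simps)
  qed
  from assms obtain k where n: "n = k + 4"
    using nat_le_iff_add[of 4 n] by (auto simp: add.commute)
  have "n - 1 = k + 3" "n - 2 = k + 2" "n - 3 = k + 1"
    by (simp_all add: n)
  then show ?thesis
    using cycle[of k] by (simp flip: sum_divide_distrib add_divide_distrib)
qed

theorem theorem2p4:
  fixes q :: complex and n :: nat and \<alpha> :: "nat \<Rightarrow> complex"
    and v :: "nat \<Rightarrow> 'a" and V :: "'a set" and E :: "'a set set" and w :: "'a set \<Rightarrow> complex"
  assumes n: "n \<ge> 4"
    and T: "weighted_tree n v V E w \<alpha>"
    and q_zero: "q = 0 \<Longrightarrow> \<forall>i\<in>{1..n - 1}. Re (\<alpha> i) > 0"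
    and denominators: "\<forall>i\<in>{1..n - 1}. qnum q (2 * \<alpha> i) \<noteq> 0"
  shows "det (q_distance_matrix q n v V E w) =
      (-1) ^ (n - 1) * (\<Prod>i=1..n - 1. qnum q (2 * \<alpha> i)) *
      (qnum q (\<alpha> 1) * qnum q (\<alpha> 2) * qnum q (\<alpha> 1 + \<alpha> 2) /
         (qnum q (2 * \<alpha> 1) * qnum q (2 * \<alpha> 2)) +
       qnum q (\<alpha> (n - 2)) * qnum q (\<alpha> (n - 1)) * qnum q (\<alpha> (n - 2) + \<alpha> (n - 1)) /
         (qnum q (2 * \<alpha> (n - 2)) * qnum q (2 * \<alpha> (n - 1))) +
       (\<Sum>i=1..n - 3. qnum q (\<alpha> i) * qnum q (\<alpha> (i + 2)) * qnum q (\<alpha> i + \<alpha> (i + 2)) /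
         (qnum q (2 * \<alpha> i) * qnum q (2 * \<alpha> (i + 2)))))
    \<and> (\<forall>(v' :: nat \<Rightarrow> 'b) V' E' w'. weighted_tree n v' V' E' w' \<alpha> \<longrightarrow>
         det (q_distance_matrix q n v' V' E' w') = det (q_distance_matrix q n v V E w))"
proof -
  \<comment> \<open>For \<open>q \<noteq> 0\<close> the domain is all of the complex plane;
    positivity of the real parts enters at \<open>q = 0\<close>.\<close>
  have dom: "\<alpha> i \<in> qpow_domain q" if "i \<in> {1..n - 1}" for i
    using q_zero that by (auto simp: qpow_domain_def)
  have nz: "qnum q (2 * \<alpha> i) \<noteq> 0" if "i \<in> {1..n - 1}" for i
    using denominators that by blast
  define f where "f i = (qnum q (\<alpha> i))\<^sup>2 / qnum q (2 * \<alpha> i)" for i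
  have pair: "qnum q (\<alpha> i) * qnum q (\<alpha> j) * qnum q (\<alpha> i + \<alpha> j) /
      (qnum q (2 * \<alpha> i) * qnum q (2 * \<alpha> j)) = (f i + f j) / 2"
    if "i \<in> {1..n - 1}" "j \<in> {1..n - 1}" for i j
    unfolding f_def by (rule qnum_pair_split) (simp_all only: dom nz that not_False_eq_True)
  have sum: "(\<Sum>i=1..n - 3. qnum q (\<alpha> i) * qnum q (\<alpha> (i + 2)) * qnum q (\<alpha> i + \<alpha> (i + 2)) /
      (qnum q (2 * \<alpha> i) * qnum q (2 * \<alpha> (i + 2)))) = (\<Sum>i=1..n - 3. (f i + f (i + 2)) / 2)"
    using n by (intro sum.cong pair) auto
  have first: "qnum q (\<alpha> 1) * qnum q (\<alpha> 2) * qnum q (\<alpha> 1 + \<alpha> 2) /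
      (qnum q (2 * \<alpha> 1) * qnum q (2 * \<alpha> 2)) = (f 1 + f 2) / 2"
    using n by (intro pair) auto
  have last: "qnum q (\<alpha> (n - 2)) * qnum q (\<alpha> (n - 1)) * qnum q (\<alpha> (n - 2) + \<alpha> (n - 1)) /
      (qnum q (2 * \<alpha> (n - 2)) * qnum q (2 * \<alpha> (n - 1))) = (f (n - 2) + f (n - 1)) / 2"
    using n by (intro pair) auto
  \<comment> \<open>The common value of the determinants of all trees with weights
    \<open>\<alpha>\<close>, whatever their vertex types \<open>'a\<close> and
    \<open>'b\<close>.\<close>
  let ?R = "(-1) ^ (n - 1) * (\<Prod>i=1..n - 1. qnum q (2 * \<alpha> i)) *
      (\<Sum>i=1..n - 1. (qnum q (\<alpha> i))\<^sup>2 / qnum q (2 * \<alpha> i))"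
  show ?thesis
    unfolding first last sum sum_over_cycle_pairs[OF n]
    unfolding f_def
  proof (intro conjI allI impI)
    show "det (q_distance_matrix q n v V E w) = ?R"
      using T dom nz by (rule det_q_distance_matrix)
    fix v' :: "nat \<Rightarrow> 'b" and V' E' w'
    assume "weighted_tree n v' V' E' w' \<alpha>"
    then have "det (q_distance_matrix q n v' V' E' w') = ?R"
      using dom nz by (rule det_q_distance_matrix)
    with \<open>det (q_distance_matrix q n v V E w) = ?R\<close>
    show "det (q_distance_matrix q n v' V' E' w') = det (q_distance_matrix q n v V E w)"
      by simp
  qed
qed

end
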